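(* Let $(\Omega,\mathcal{F},\mathbb{P})$ be a probability space, $n\in\mathbb{N}$, $I\subseteq(0,\infty)$ an interval, $E\subseteq L^\infty_{++}$ a GG-convex cone with $(0,\infty)\subseteq E$ (positive constants), and assume that $E_I=\{X\in E: X(\omega)\in I\ \text{a.s.}\}$ is a GG-convex cone. Let $\tilde\rho:E^n\to(0,\infty)$ be a systemic return risk measure that is GG-convex and positively homogeneous. Then $\tilde\rho$ satisfies risk GG-convexity: for all $\mathbf{X},\mathbf{Y},\mathbf{Z}\in E^n$ and $\lambda\in(0,1)$ with $\tilde\rho(\mathbf{Z}(\omega))=\tilde\rho(\mathbf{X}(\omega))^\lambda\tilde\rho(\mathbf{Y}(\omega))^{1-\lambda}$ for almost every $\omega$, it holds that $\tilde\rho(\mathbf{Z})\le\tilde\rho(\mathbf{X})^\lambda\tilde\rho(\mathbf{Y})^{1-\lambda}$.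
   Context: $L^\infty_{++}$ is the set of (classes of) essentially bounded real random variables $X$ with $X>0$ a.s. A set $C$ is a cone if $\lambda C\subseteq C$ for all $\lambda>0$; it is GG-convex if $x^\lambda y^{1-\lambda}\in C$ for all $x,y\in C$, $\lambda\in(0,1)$ (powers and products pointwise and componentwise). A map $\tilde\rho:E^n\to(0,\infty)$ is GG-convex if $\tilde\rho(\mathbf{X}^\lambda\mathbf{Y}^{1-\lambda})\le\tilde\rho(\mathbf{X})^\lambda\tilde\rho(\mathbf{Y})^{1-\lambda}$ for all $\mathbf{X},\mathbf{Y}\in E^n$, $\lambda\in(0,1)$; positively homogeneous if $\tilde\rho(\lambda\mathbf{X})=\lambda\tilde\rho(\mathbf{X})$ for $\lambda>0$; increasing if $\mathbf{X}\le\mathbf{Y}$ (a.s., componentwise) implies $\tilde\rho(\mathbf{X})\le\tilde\rho(\mathbf{Y})$. Vectors in $(0,\infty)^n$ are identified with constant elements of $E^n$. An increasing map $\tilde\rho:E^n\to(0,\infty)$ is a systemic return risk measure if: (1) $\tilde\rho((0,\infty)^n)=I$; (2) $\{\omega\mapsto\tilde\rho(\mathbf{X}(\omega)):\mathbf{X}\in E^n\}=E_I$; (3) (preference consistency) for $\mathbf{X},\mathbf{Y}\in E^n$, $\tilde\rho(\mathbf{X}(\omega))\le\tilde\rho(\mathbf{Y}(\omega))$ for a.e. $\omega$ implies $\tilde\rho(\mathbf{X})\le\tilde\rho(\mathbf{Y})$. *)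

theory Defs
  imports "HOL-Probability.Probability"
begin

text \<open>
  Classes of random variables modulo almost sure equality are handled through their
  representatives: a set of classes is a set of measurable functions that is closed under
  almost sure equality (\<open>ae_saturated\<close>).
\<close>

definition Linf_pp :: "'a measure \<Rightarrow> ('a \<Rightarrow> real) set" where
  "Linf_pp M = {X \<in> borel_measurable M.
     (AE \<omega> in M. X \<omega> > 0) \<and> (\<exists>B. AE \<omega> in M. \<bar>X \<omega>\<bar> \<le> B)}"

definition ae_saturated :: "'a measure \<Rightarrow> ('a \<Rightarrow> real) set \<Rightarrow> bool" where
  "ae_saturated M E \<longleftrightarrow>
     (\<forall>X\<in>E. \<forall>Y\<in>borel_measurable M. (AE \<omega> in M. X \<omega> = Y \<omega>) \<longrightarrow> Y \<in> E)"

definition ae_class :: "'a measure \<Rightarrow> ('a \<Rightarrow> real) \<Rightarrow> ('a \<Rightarrow> real) set" where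
  "ae_class M X = {Y. AE \<omega> in M. Y \<omega> = X \<omega>}"

definition rv_cone :: "('a \<Rightarrow> real) set \<Rightarrow> bool" where
  "rv_cone C \<longleftrightarrow> (\<forall>l>0. \<forall>X\<in>C. (\<lambda>\<omega>. l * X \<omega>) \<in> C)"

definition rv_gg_convex :: "('a \<Rightarrow> real) set \<Rightarrow> bool" where
  "rv_gg_convex C \<longleftrightarrow> (\<forall>X\<in>C. \<forall>Y\<in>C. \<forall>l\<in>{0<..<1}.
     (\<lambda>\<omega>. X \<omega> powr l * Y \<omega> powr (1 - l)) \<in> C)"

definition restrict_range :: "'a measure \<Rightarrow> ('a \<Rightarrow> real) set \<Rightarrow> real set \<Rightarrow> ('a \<Rightarrow> real) set" where
  "restrict_range M E I = {X \<in> E. AE \<omega> in M. X \<omega> \<in> I}"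

definition vec_rv :: "('a \<Rightarrow> real) set \<Rightarrow> ('a \<Rightarrow> real ^ 'n) set" where
  "vec_rv E = {X. \<forall>i. (\<lambda>\<omega>. X \<omega> $ i) \<in> E}"

definition geo_comb :: "real \<Rightarrow> real ^ 'n \<Rightarrow> real ^ 'n \<Rightarrow> real ^ 'n" where
  "geo_comb l x y = (\<chi> i. (x $ i) powr l * (y $ i) powr (1 - l))"

text \<open>Value of a functional at a deterministic vector, seen as a constant random vector.\<close>

definition at_const :: "(('a \<Rightarrow> real ^ 'n) \<Rightarrow> real) \<Rightarrow> real ^ 'n \<Rightarrow> real" where
  "at_const \<rho> v = \<rho> (\<lambda>_. v)"

text \<open>
  For \<open>\<rho> X\<close> to be a function of the almost sure class of \<open>X\<close> no separate condition is
  needed: it follows from monotonicity with respect to the almost sure order.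
\<close>

definition rm_increasing ::
  "'a measure \<Rightarrow> ('a \<Rightarrow> real) set \<Rightarrow> (('a \<Rightarrow> real ^ 'n) \<Rightarrow> real) \<Rightarrow> bool" where
  "rm_increasing M E \<rho> \<longleftrightarrow> (\<forall>X\<in>vec_rv E. \<forall>Y\<in>vec_rv E.
     (AE \<omega> in M. \<forall>i. X \<omega> $ i \<le> Y \<omega> $ i) \<longrightarrow> \<rho> X \<le> \<rho> Y)"

definition rm_gg_convex ::
  "('a \<Rightarrow> real) set \<Rightarrow> (('a \<Rightarrow> real ^ 'n) \<Rightarrow> real) \<Rightarrow> bool" where
  "rm_gg_convex E \<rho> \<longleftrightarrow> (\<forall>X\<in>vec_rv E. \<forall>Y\<in>vec_rv E. \<forall>l\<in>{0<..<1}.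
     \<rho> (\<lambda>\<omega>. geo_comb l (X \<omega>) (Y \<omega>)) \<le> \<rho> X powr l * \<rho> Y powr (1 - l))"

definition rm_pos_homogeneous ::
  "('a \<Rightarrow> real) set \<Rightarrow> (('a \<Rightarrow> real ^ 'n) \<Rightarrow> real) \<Rightarrow> bool" where
  "rm_pos_homogeneous E \<rho> \<longleftrightarrow> (\<forall>X\<in>vec_rv E. \<forall>l>0. \<rho> (\<lambda>\<omega>. l *\<^sub>R X \<omega>) = l * \<rho> X)"

text \<open>
  The fourth conjunct is an equality of sets of almost sure classes. The map
  \<open>\<omega> \<mapsto> \<rho> (X \<omega>)\<close> is only determined almost surely, because a representative \<open>X\<close> may
  leave the positive orthant on a null set; \<open>ae_class\<close> therefore does not require its members
  to be measurable.
\<close>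

definition systemic_return_risk_measure ::
  "'a measure \<Rightarrow> ('a \<Rightarrow> real) set \<Rightarrow> real set \<Rightarrow> (('a \<Rightarrow> real ^ 'n) \<Rightarrow> real) \<Rightarrow> bool" where
  "systemic_return_risk_measure M E I \<rho> \<longleftrightarrow>
     (\<forall>X\<in>vec_rv E. 0 < \<rho> X) \<and>
     rm_increasing M E \<rho> \<and>
     at_const \<rho> ` {v. \<forall>i. 0 < v $ i} = I \<and>
     {ae_class M (\<lambda>\<omega>. at_const \<rho> (X \<omega>)) | X. X \<in> vec_rv E} = ae_class M ` restrict_range M E I \<and>
     (\<forall>X\<in>vec_rv E. \<forall>Y\<in>vec_rv E.
        (AE \<omega> in M. at_const \<rho> (X \<omega>) \<le> at_const \<rho> (Y \<omega>)) \<longrightarrow> \<rho> X \<le> \<rho> Y)"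

definition risk_gg_convex ::
  "'a measure \<Rightarrow> ('a \<Rightarrow> real) set \<Rightarrow> (('a \<Rightarrow> real ^ 'n) \<Rightarrow> real) \<Rightarrow> bool" where
  "risk_gg_convex M E \<rho> \<longleftrightarrow>
     (\<forall>X\<in>vec_rv E. \<forall>Y\<in>vec_rv E. \<forall>Z\<in>vec_rv E. \<forall>l\<in>{0<..<1}.
        (AE \<omega> in M. at_const \<rho> (Z \<omega>) = at_const \<rho> (X \<omega>) powr l * at_const \<rho> (Y \<omega>) powr (1 - l))
        \<longrightarrow> \<rho> Z \<le> \<rho> X powr l * \<rho> Y powr (1 - l))"

end

theory Submission imports Defs begin

text \<open>
  By preference consistency \<open>\<rho> X\<close> depends only on the random variable
  \<open>U \<omega> = \<rho> (X \<omega>)\<close>, which lies in \<open>E\<close>. Positive homogeneity on constants shows that the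
  random vector with all components equal to \<open>U / \<rho> 1\<close> induces the same \<open>U\<close>, so \<open>X\<close> and \<open>Y\<close>
  may be replaced by such diagonal vectors. The geometric combination of two diagonal vectors
  is diagonal and has the same state-wise risk as \<open>Z\<close>, hence GG-convexity of \<open>\<rho>\<close> applies.
\<close>

lemma at_const_scaleR:
  fixes \<rho> :: "('a \<Rightarrow> real ^ 'n) \<Rightarrow> real"
  assumes "\<forall>c>0. (\<lambda>_. c) \<in> E" and "rm_pos_homogeneous E \<rho>"
    and "\<And>i. 0 < v $ i" and "0 < t"
  shows "at_const \<rho> (t *\<^sub>R v) = t * at_const \<rho> v"
proof -
  have "(\<lambda>_. v) \<in> vec_rv E"
    using assms(1,3) by (simp add: vec_rv_def)
  with assms(2,4) show ?thesis
    by (simp add: rm_pos_homogeneous_def at_const_def)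
qed

text \<open>The range condition yields some \<open>U\<close> in \<open>E\<close> with the same class
  as the state-wise risk. Since \<open>ae_class\<close> asks for no measurability, the state-wise
  risk belongs to its own class, hence to that of \<open>U\<close>, and this membership is almost
  sure equality.\<close>

lemma statewise_risk_representative:
  assumes "systemic_return_risk_measure M E I \<rho>" and "X \<in> vec_rv E"
  obtains U where "U \<in> E" and "AE \<omega> in M. at_const \<rho> (X \<omega>) = U \<omega>"
proof -
  have "ae_class M (\<lambda>\<omega>. at_const \<rho> (X \<omega>)) \<in> ae_class M ` restrict_range M E I"
    using assms unfolding systemic_return_risk_measure_def by blast
  then obtain U where U: "U \<in> restrict_range M E I"
    and eq: "ae_class M (\<lambda>\<omega>. at_const \<rho> (X \<omega>)) = ae_class M U"
    by blast
  have "(\<lambda>\<omega>. at_const \<rho> (X \<omega>)) \<in> ae_class M U"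
    unfolding eq[symmetric] by (simp add: ae_class_def)
  with U show ?thesis
    by (intro that[of U]) (auto simp: ae_class_def restrict_range_def)
qed

text \<open>Almost sure equality gives both almost sure inequalities, and preference consistency
  applies to each.\<close>

lemma preference_consistent_eq:
  assumes "systemic_return_risk_measure M E I \<rho>" and "X \<in> vec_rv E" and "Y \<in> vec_rv E"
    and "AE \<omega> in M. at_const \<rho> (X \<omega>) = at_const \<rho> (Y \<omega>)"
  shows "\<rho> X = \<rho> Y"
proof (rule antisym)
  have "AE \<omega> in M. at_const \<rho> (X \<omega>) \<le> at_const \<rho> (Y \<omega>)"
    using assms(4) by eventually_elim simp
  then show "\<rho> X \<le> \<rho> Y"
    using assms(1-3) by (simp add: systemic_return_risk_measure_def)
  have "AE \<omega> in M. at_const \<rho> (Y \<omega>) \<le> at_const \<rho> (X \<omega>)"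
    using assms(4) by eventually_elim simp
  then show "\<rho> Y \<le> \<rho> X"
    using assms(1-3) by (simp add: systemic_return_risk_measure_def)
qed

lemma diagonal_representative:
  fixes \<rho> :: "('a \<Rightarrow> real ^ 'n) \<Rightarrow> real"
  assumes "E \<subseteq> Linf_pp M" and "rv_cone E"
    and "\<forall>c>0. (\<lambda>_. c) \<in> E"
    and "systemic_return_risk_measure M E I \<rho>" and "rm_pos_homogeneous E \<rho>"
    and "X \<in> vec_rv E"
  obtains W where "W \<in> E" and "AE \<omega> in M. 0 < W \<omega>"
    and "AE \<omega> in M. at_const \<rho> (X \<omega>) = W \<omega> * at_const \<rho> 1"
    and "\<rho> (\<lambda>\<omega>. W \<omega> *\<^sub>R 1) = \<rho> X"
proof -
  \<comment> \<open>The \<open>1\<close> is the all-ones vector, so by homogeneity a diagonal vector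
    with entry \<open>w > 0\<close> has risk \<open>w * a\<close>.\<close>
  define a where "a = at_const \<rho> 1"
  have "(\<lambda>_. 1) \<in> vec_rv E"
    using assms(3) by (simp add: vec_rv_def)
  then have a: "0 < a"
    using assms(4) by (auto simp: a_def at_const_def systemic_return_risk_measure_def)
  obtain U where U: "U \<in> E" "AE \<omega> in M. at_const \<rho> (X \<omega>) = U \<omega>"
    using statewise_risk_representative[OF assms(4,6)] .
  \<comment> \<open>Dividing by \<open>a\<close> makes the diagonal vector of \<open>W\<close> have
    state-wise risk \<open>U\<close>; the cone property keeps \<open>W\<close> in
    \<open>E\<close>.\<close>
  define W where "W = (\<lambda>\<omega>. inverse a * U \<omega>)"
  have W: "W \<in> E"
    using assms(2) U(1) a unfolding W_def rv_cone_def by simp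
  then have pos: "AE \<omega> in M. 0 < W \<omega>"
    using assms(1) by (auto simp: Linf_pp_def)
  have risk: "AE \<omega> in M. at_const \<rho> (X \<omega>) = W \<omega> * a"
    using U(2) by eventually_elim (use a in \<open>simp add: W_def\<close>)
  \<comment> \<open>Homogeneity is applied state by state, with the factor
    \<open>W \<omega>\<close>, which is positive almost surely.\<close>
  have "AE \<omega> in M. at_const \<rho> (W \<omega> *\<^sub>R 1) = at_const \<rho> (X \<omega>)"
    using risk pos
    by eventually_elim (simp add: a_def at_const_scaleR[OF assms(3,5)])
  moreover have "(\<lambda>\<omega>. W \<omega> *\<^sub>R 1) \<in> vec_rv E"
    using W by (simp add: vec_rv_def)
  ultimately have "\<rho> (\<lambda>\<omega>. W \<omega> *\<^sub>R 1) = \<rho> X"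
    by (intro preference_consistent_eq[OF assms(4) _ assms(6)])
  with W pos risk show ?thesis
    unfolding a_def by (rule that)
qed

theorem proposition4p9:
  fixes M :: "'a measure" and E :: "('a \<Rightarrow> real) set" and I :: "real set"
    and \<rho> :: "('a \<Rightarrow> real ^ 'n) \<Rightarrow> real"
  assumes "prob_space M"
    and "I \<subseteq> {0<..}" and "is_interval I"
    and "E \<subseteq> Linf_pp M" and "ae_saturated M E"
    and "rv_cone E" and "rv_gg_convex E"
    and "\<And>c. 0 < c \<Longrightarrow> (\<lambda>_. c) \<in> E"
    and "rv_cone (restrict_range M E I)" and "rv_gg_convex (restrict_range M E I)"
    and "systemic_return_risk_measure M E I \<rho>"
    and "rm_gg_convex E \<rho>" and "rm_pos_homogeneous E \<rho>"
  shows "risk_gg_convex M E \<rho>"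
proof -
  have const: "\<forall>c>0. (\<lambda>_. c) \<in> E"
    using assms(8) by blast
  define a where "a = at_const \<rho> 1"
  have "(\<lambda>_. 1) \<in> vec_rv E"
    using assms(8) by (simp add: vec_rv_def)
  then have a: "0 < a"
    using assms(11) by (auto simp: a_def at_const_def systemic_return_risk_measure_def)
  have "\<rho> Z \<le> \<rho> X powr l * \<rho> Y powr (1 - l)"
    if X: "X \<in> vec_rv E" and Y: "Y \<in> vec_rv E" and Z: "Z \<in> vec_rv E" and l: "l \<in> {0<..<1}"
      and eq: "AE \<omega> in M. at_const \<rho> (Z \<omega>) =
        at_const \<rho> (X \<omega>) powr l * at_const \<rho> (Y \<omega>) powr (1 - l)"
    for X Y Z l
  proof -
    note diag = diagonal_representative[OF assms(4,6) const assms(11,13)]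
    obtain U where U: "U \<in> E" "AE \<omega> in M. 0 < U \<omega>"
      "AE \<omega> in M. at_const \<rho> (X \<omega>) = U \<omega> * a" "\<rho> (\<lambda>\<omega>. U \<omega> *\<^sub>R 1) = \<rho> X"
      unfolding a_def by (rule diag[OF X])
    obtain V where V: "V \<in> E" "AE \<omega> in M. 0 < V \<omega>"
      "AE \<omega> in M. at_const \<rho> (Y \<omega>) = V \<omega> * a" "\<rho> (\<lambda>\<omega>. V \<omega> *\<^sub>R 1) = \<rho> Y"
      unfolding a_def by (rule diag[OF Y])
    \<comment> \<open>The entry of the diagonal vector that will replace \<open>Z\<close>;
      GG-convexity of \<open>E\<close> makes it admissible.\<close>
    define W where "W = (\<lambda>\<omega>. U \<omega> powr l * V \<omega> powr (1 - l))"
    have "W \<in> E"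
      using assms(7) U(1) V(1) l by (simp add: W_def rv_gg_convex_def)
    then have W: "(\<lambda>\<omega>. W \<omega> *\<^sub>R 1) \<in> vec_rv E"
      by (simp add: vec_rv_def)
    have "AE \<omega> in M. at_const \<rho> (Z \<omega>) = at_const \<rho> (W \<omega> *\<^sub>R 1)"
      using eq U(2,3) V(2,3)
    proof eventually_elim
      case (elim \<omega>)
      \<comment> \<open>The exponents \<open>l\<close> and \<open>1 - l\<close> add up to 1, so the
        factors of \<open>a\<close> recombine to a single \<open>a\<close>. Positivity of
        \<open>U \<omega>\<close> and \<open>V \<omega>\<close> passes to \<open>W \<omega>\<close>,
        so homogeneity applies again.\<close>
      have "at_const \<rho> (Z \<omega>) = W \<omega> * (a powr l * a powr (1 - l))"
        using elim a by (simp add: W_def powr_mult)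
      also have "a powr l * a powr (1 - l) = a"
        using a by (simp flip: powr_add)
      also have "W \<omega> * a = at_const \<rho> (W \<omega> *\<^sub>R 1)"
        using elim by (simp add: a_def W_def at_const_scaleR[OF const assms(13)])
      finally show ?case .
    qed
    then have "\<rho> Z = \<rho> (\<lambda>\<omega>. W \<omega> *\<^sub>R 1)"
      by (rule preference_consistent_eq[OF assms(11) Z W])
    \<comment> \<open>Both arguments of \<open>\<rho>\<close> agree in every state, not just almost
      surely: each component is the same \<open>powr\<close> expression.\<close>
    also have "\<dots> = \<rho> (\<lambda>\<omega>. geo_comb l (U \<omega> *\<^sub>R 1) (V \<omega> *\<^sub>R 1))"
      by (intro arg_cong[of _ _ \<rho>]) (simp add: geo_comb_def W_def vec_eq_iff fun_eq_iff)
    also have "\<dots> \<le> \<rho> (\<lambda>\<omega>. U \<omega> *\<^sub>R 1) powr l * \<rho> (\<lambda>\<omega>. V \<omega> *\<^sub>R 1) powr (1 - l)"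
    proof -
      have "(\<lambda>\<omega>. U \<omega> *\<^sub>R 1) \<in> vec_rv E" "(\<lambda>\<omega>. V \<omega> *\<^sub>R 1) \<in> vec_rv E"
        using U(1) V(1) by (simp_all add: vec_rv_def)
      then show ?thesis
        using assms(12)[unfolded rm_gg_convex_def, rule_format, of _ _ l] l by simp
    qed
    finally show ?thesis
      unfolding U(4) V(4) .
  qed
  then show ?thesis
    unfolding risk_gg_convex_def by (intro ballI impI)
qed

end
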